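(* Let $P_1\in\mathcal{C}(G_n)$ and $P_2\in\mathcal{S}(P_1)$ and let $\mathrm{char}(P_1)=C_1$ and $\mathrm{char}(P_2)=C_2$. Let $1\leq k \leq n+1$. Then $$\mathrm{char}(P_1\,\mathrm{stack}_k^1\, P_2) = \{T^k \cup \{k\} : T \in C_1\cap C_2\}\cup\{\emptyset\}.$$
   Context: Let $Q_n=\{1,\dots,n\}$ be a set of $n$ yes/no questions. An outcome on a set $S\subseteq Q_n$ is an element of $\{0,1\}^{|S|}$, and $X_S$ denotes the set of all outcomes on $S$. A preference matrix on $Q_n$ is a $2^n\times n$ 0-1 matrix whose rows are the $2^n$ outcomes on $Q_n$, each appearing exactly once, ordered from most to least preferred. For a nonempty proper subset $S\subset Q_n$ and outcome $x$ on $Q_n-S$, $P^{[Q_n-S,x]}$ is the submatrix of $P$ formed by the columns in $S$ and the rows whose outcome on $Q_n-S$ is $x$ (in order). $S$ is separable with respect to $P$ if $P^{[Q_n-S,x]}=P^{[Q_n-S,y]}$ for all $x,y\in X_{Q_n-S}$; $\emptyset$ and $Q_n$ are always separable. The character $\mathrm{char}(P)$ is the set of all subsets of $Q_n$ separable with respect to $P$. $\mathcal{C}(G_n)$ is the set of preference matrices generated by Hamiltonian paths in the $n$-dimensional hypercube graph $G_n$ with Gray code labeling, i.e. preference matrices in which consecutive rows differ in exactly one entry. For $A\in\mathcal{C}(G_n)$, $\mathcal{S}(A)$ is the set of $B\in\mathcal{C}(G_n)$ whose first row equals the last row of $A$. For $B\in\mathcal{S}(A)$ and $k\in\{1,\dots,n+1\}$,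 $A\,\mathrm{stack}_k^1\,B$ is the $2^{n+1}\times(n+1)$ matrix obtained by placing $A$ above $B$ and inserting a new column in position $k$ (shifting later columns right) whose first $2^n$ entries are $1$ and last $2^n$ entries are $0$. For $T\subseteq Q_n$, $T^k=\{q\in T : q<k\}\cup\{q+1 : q\in T \text{ and } q \geq k\}$. *)

theory Defs
  imports "HOL-Library.FuncSet" "Jordan_Normal_Form.Matrix" "Jordan_Normal_Form.DL_Submatrix"
begin

definition questions :: "nat \<Rightarrow> nat set" where
  "questions n = {1..n}"

(* An element of {0,1}^|S| is indexed by the questions in S themselves. *)
definition outcomes :: "nat set \<Rightarrow> (nat \<Rightarrow> nat) set" where
  "outcomes S = S \<rightarrow>\<^sub>E {0, 1}"

(* Matrix rows and columns are numbered from 0, questions from 1: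
   question q is column q - 1. *)
definition outcome_at :: "nat mat \<Rightarrow> nat set \<Rightarrow> nat \<Rightarrow> nat \<Rightarrow> nat" where
  "outcome_at P S i = (\<lambda>q\<in>S. P $$ (i, q - 1))"

definition preference_matrix :: "nat \<Rightarrow> nat mat \<Rightarrow> bool" where
  "preference_matrix n P \<longleftrightarrow>
     P \<in> carrier_mat (2 ^ n) n \<and>
     bij_betw (outcome_at P (questions n)) {..<2 ^ n} (outcomes (questions n))"

(* The matrix P^[Q_n - S, x], where x is an outcome on Q_n - S. *)
definition restricted_matrix :: "nat \<Rightarrow> nat mat \<Rightarrow> nat set \<Rightarrow> (nat \<Rightarrow> nat) \<Rightarrow> nat mat" where
  "restricted_matrix n P S x =
     submatrix P {i. i < 2 ^ n \<and> outcome_at P (questions n - S) i = x} {q - 1 | q. q \<in> S}"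

definition separable :: "nat \<Rightarrow> nat mat \<Rightarrow> nat set \<Rightarrow> bool" where
  "separable n P S \<longleftrightarrow>
     S = {} \<or> S = questions n \<or>
     (\<forall>x\<in>outcomes (questions n - S). \<forall>y\<in>outcomes (questions n - S).
        restricted_matrix n P S x = restricted_matrix n P S y)"

definition character :: "nat \<Rightarrow> nat mat \<Rightarrow> nat set set" where
  "character n P = {S. S \<subseteq> questions n \<and> separable n P S}"

(* The set C(G_n): the rows of P, read from top to bottom, visit every vertex of the
   n-dimensional hypercube exactly once and move along an edge at each step. *)
definition hamiltonian_matrices :: "nat \<Rightarrow> nat mat set" where
  "hamiltonian_matrices n =
     {P. preference_matrix n P \<and>
         (\<forall>i. Suc i < 2 ^ n \<longrightarrow> card {j. j < n \<and> P $$ (i, j) \<noteq> P $$ (Suc i, j)} = 1)}"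

(* The set S(A). *)
definition stackable :: "nat \<Rightarrow> nat mat \<Rightarrow> nat mat set" where
  "stackable n A = {B \<in> hamiltonian_matrices n. row B 0 = row A (2 ^ n - 1)}"

(* A stack_k^1 B; position k of the new column is counted from 1. *)
definition stack1 :: "nat \<Rightarrow> nat mat \<Rightarrow> nat mat \<Rightarrow> nat mat" where
  "stack1 k A B =
     mat (dim_row A + dim_row B) (dim_col A + 1)
       (\<lambda>(i, j). if j = k - 1 then (if i < dim_row A then 1 else 0)
                 else (A @\<^sub>r B) $$ (i, if j < k - 1 then j else j - 1))"

(* The set T^k. *)
definition shift_set :: "nat \<Rightarrow> nat set \<Rightarrow> nat set" where
  "shift_set k T = {q \<in> T. q < k} \<union> {q + 1 | q. q \<in> T \<and> q \<ge> k}"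

end

theory Submission
  imports Defs
begin

text \<open>
  A set \<open>S\<close> is separable iff the list of restrictions to \<open>S\<close> of those rows that agree with
  \<open>x\<close> off \<open>S\<close> does not depend on \<open>x\<close>. For the stacked matrix this list is a concatenation of
  one list from each block. If \<open>k\<close> is in \<open>S\<close>, the entry in column \<open>k\<close> tells the two parts apart,
  so the concatenation is constant iff both parts are. If \<open>k\<close> is not in \<open>S\<close>, only one of the
  two parts is nonempty, and which one depends on \<open>x k\<close>. Taking the common row
  \<open>r\<close> of the blocks as the remaining values of \<open>x\<close>, the list from the upper block ends, and the
  one from the lower block begins, with the restriction of \<open>r\<close> to \<open>S\<close>; the lists differ because
  each is free of repetitions and has more than one element.
\<close>

text \<open>Rows are given by an arbitrary function of row number and question, and \<open>S\<close>
  and \<open>C\<close> are independent, so that each block and the stack can be treated alike.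
  Keeping the questions as indices of the entries avoids renumbering columns as
  \<open>submatrix\<close> does.\<close>

definition slice :: "nat \<Rightarrow> (nat \<Rightarrow> nat \<Rightarrow> nat) \<Rightarrow> nat set \<Rightarrow> nat set \<Rightarrow> (nat \<Rightarrow> nat) \<Rightarrow> (nat \<Rightarrow> nat) list"
  where "slice N F S C x = map (\<lambda>i. restrict (F i) S) (filter (\<lambda>i. \<forall>q\<in>C. F i q = x q) [0..<N])"

text \<open>Outcomes are unconstrained outside \<open>C\<close>, which lets them be composed with
  renumberings of the questions without being restricted again.\<close>

definition uniform :: "nat \<Rightarrow> (nat \<Rightarrow> nat \<Rightarrow> nat) \<Rightarrow> nat set \<Rightarrow> nat set \<Rightarrow> bool"
  where "uniform N F S C \<longleftrightarrow>
    (\<forall>x \<in> C \<rightarrow> {0, 1}. \<forall>y \<in> C \<rightarrow> {0, 1}. slice N F S C x = slice N F S C y)"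

definition entry :: "nat mat \<Rightarrow> nat \<Rightarrow> nat \<Rightarrow> nat"
  where "entry P i q = P $$ (i, q - 1)"

lemma outcome_at_entry: "outcome_at P S i = restrict (entry P i) S"
  by (simp add: outcome_at_def entry_def[abs_def])

lemma slice_cong:
  assumes "\<And>q. q \<in> C \<Longrightarrow> x q = y q"
  shows "slice N F S C x = slice N F S C y"
  using assms unfolding slice_def by (auto intro: arg_cong[where f = "map _"] filter_cong)

section \<open>Separability in terms of lists of restricted rows\<close>

lemma filter_mem_upt_eq_nths: "filter (\<lambda>i. i \<in> I) [0..<m] = nths [0..<m] I"
  by (induction m) (simp_all add: nths_append)

text \<open>Row \<open>i\<close> of the submatrix and entry \<open>i\<close> of the list both come
  from row \<open>pick I i\<close> of \<open>A\<close>, and the number of rows is the length of the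
  list. The columns correspond to the questions in \<open>S\<close> through
  \<open>pick J\<close>.\<close>

lemma submatrix_eq_iff:
  fixes A :: "nat mat"
  assumes A: "A \<in> carrier_mat N n" and S: "S \<subseteq> {1..n}" and J: "J = {q - 1 | q. q \<in> S}"
  shows "submatrix A I J = submatrix A I' J \<longleftrightarrow>
    map (\<lambda>i. restrict (entry A i) S) (filter (\<lambda>i. i \<in> I) [0..<N]) =
    map (\<lambda>i. restrict (entry A i) S) (filter (\<lambda>i. i \<in> I') [0..<N])" (is "_ \<longleftrightarrow> ?l I = ?l I'")
proof -
  have len: "length (?l I) = card {i. i < N \<and> i \<in> I}" for I
    by (simp add: length_filter_conv_card cong: conj_cong)
  have nth: "?l I ! i = restrict (entry A (pick I i)) S" if "i < card {i. i < N \<and> i \<in> I}" for I i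
  proof -
    have "filter (\<lambda>i. i \<in> I) [0..<N] ! i = pick I i"
      using that pick_le[OF that] by (simp add: filter_mem_upt_eq_nths nth_nths)
    moreover have "i < length (filter (\<lambda>i. i \<in> I) [0..<N])"
      using that len[of I] by simp
    ultimately show ?thesis
      by (simp only: nth_map)
  qed
  have Jn: "{j. j < n \<and> j \<in> J} = J"
    using S unfolding J by fastforce
  have finJ: "finite J"
    using Jn by (metis finite_Collect_conjI finite_Collect_less_nat)
  show ?thesis
  proof
    assume eq: "submatrix A I J = submatrix A I' J"
    have c: "card {i. i < N \<and> i \<in> I} = card {i. i < N \<and> i \<in> I'}"
      using arg_cong[OF eq, of dim_row] A by (simp add: dim_submatrix)
    show "?l I = ?l I'"
    proof (rule nth_equalityI)
      show "length (?l I) = length (?l I')"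
        by (simp only: len c)
      fix i assume "i < length (?l I)"
      then have i: "i < card {i. i < N \<and> i \<in> I}"
        by (simp only: len)
      have "entry A (pick I i) q = entry A (pick I' i) q" if q: "q \<in> S" for q
      proof -
        \<comment> \<open>The position of column \<open>q - 1\<close> among the selected columns is
          the number of selected columns before it.\<close>
        define j where "j = card {a \<in> J. a < q - 1}"
        have qJ: "q - 1 \<in> J"
          using q J by auto
        have "{a \<in> J. a < q - 1} \<subset> J"
          using qJ by auto
        then have j: "j < card J"
          unfolding j_def by (rule psubset_card_mono[OF finJ])
        have "pick J j = q - 1"
          unfolding j_def by (rule pick_card_in_set[OF qJ])
        then show ?thesis
          using arg_cong[OF eq, of "\<lambda>M. M $$ (i, j)"] A i j c Jn
          by (simp add: submatrix_index entry_def)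
      qed
      then show "?l I ! i = ?l I' ! i"
        using nth i c by (simp add: restrict_def fun_eq_iff)
    qed
  next
    assume eq: "?l I = ?l I'"
    then have c: "card {i. i < N \<and> i \<in> I} = card {i. i < N \<and> i \<in> I'}"
      using len by metis
    show "submatrix A I J = submatrix A I' J"
    proof (rule eq_matI)
      fix i j assume "i < dim_row (submatrix A I' J)" "j < dim_col (submatrix A I' J)"
      then have i: "i < card {i. i < N \<and> i \<in> I'}" and j: "j < card J"
        using A Jn by (auto simp: dim_submatrix)
      obtain q where q: "q \<in> S" "pick J j = q - 1"
        using pick_in_set_le[OF j] J by auto
      have "restrict (entry A (pick I i)) S q = restrict (entry A (pick I' i)) S q"
        using nth[of i I] nth[of i I'] i c eq by simp
      then show "submatrix A I J $$ (i, j) = submatrix A I' J $$ (i, j)"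
        using A i j c Jn q by (simp add: submatrix_index entry_def)
    qed (use A c in \<open>simp_all add: dim_submatrix\<close>)
  qed
qed

lemma restrict_eq_iff: "restrict f S = restrict g S \<longleftrightarrow> (\<forall>q\<in>S. f q = g q)"
  by (auto simp: restrict_def fun_eq_iff)

lemma restricted_matrix_eq_iff:
  assumes P: "P \<in> carrier_mat (2 ^ n) n" and S: "S \<subseteq> questions n"
    and x: "x \<in> outcomes (questions n - S)" and y: "y \<in> outcomes (questions n - S)"
  shows "restricted_matrix n P S x = restricted_matrix n P S y \<longleftrightarrow>
    slice (2 ^ n) (entry P) S (questions n - S) x = slice (2 ^ n) (entry P) S (questions n - S) y"
proof -
  let ?C = "questions n - S"
  have *: "filter (\<lambda>i. i \<in> {i. i < 2 ^ n \<and> outcome_at P ?C i = z}) [0..<2 ^ n] =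
      filter (\<lambda>i. \<forall>q\<in>?C. entry P i q = z q) [0..<2 ^ n]" if "z \<in> outcomes ?C" for z
  proof (rule filter_cong[OF refl])
    fix i :: nat assume i: "i \<in> set [0..<2 ^ n]"
    \<comment> \<open>Outcomes are \<open>undefined\<close> off their domain, so equality with
      \<open>outcome_at\<close> as functions is agreement on \<open>?C\<close>.\<close>
    have "restrict z ?C = z"
      using that by (simp add: outcomes_def)
    then have "outcome_at P ?C i = z \<longleftrightarrow> (\<forall>q\<in>?C. entry P i q = z q)"
      using restrict_eq_iff[of "entry P i" ?C z] by (simp only: outcome_at_entry)
    then show "i \<in> {i. i < 2 ^ n \<and> outcome_at P ?C i = z} \<longleftrightarrow> (\<forall>q\<in>?C. entry P i q = z q)"
      using i by simp
  qed
  show ?thesis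
    unfolding restricted_matrix_def
      submatrix_eq_iff[OF P S[unfolded questions_def] refl] *[OF x] *[OF y] slice_def ..
qed

lemma uniform_iff_outcomes:
  "uniform N F S C \<longleftrightarrow>
    (\<forall>x\<in>outcomes C. \<forall>y\<in>outcomes C. slice N F S C x = slice N F S C y)"
proof
  show "uniform N F S C \<Longrightarrow>
      \<forall>x\<in>outcomes C. \<forall>y\<in>outcomes C. slice N F S C x = slice N F S C y"
    by (auto simp: uniform_def outcomes_def PiE_def)
next
  assume *: "\<forall>x\<in>outcomes C. \<forall>y\<in>outcomes C. slice N F S C x = slice N F S C y"
  have "slice N F S C x = slice N F S C y" if "x \<in> C \<rightarrow> {0, 1}" "y \<in> C \<rightarrow> {0, 1}" for x y
  proof -
    have "restrict x C \<in> outcomes C" "restrict y C \<in> outcomes C"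
      using that by (auto simp: outcomes_def)
    then have "slice N F S C (restrict x C) = slice N F S C (restrict y C)"
      using * by blast
    then show ?thesis
      using slice_cong[of C x "restrict x C" N F S] slice_cong[of C y "restrict y C" N F S] by simp
  qed
  then show "uniform N F S C"
    unfolding uniform_def by blast
qed

text \<open>Only the dimensions are assumed, since this will be applied to the stacked matrix. For
  such a matrix, uniformity of the empty set would say that all outcomes occur equally often, hence
  \<open>S \<noteq> {}\<close>. For \<open>S = questions n\<close> no condition is left on the rows,
  and both sides hold.\<close>

lemma separable_iff_uniform:
  assumes P: "P \<in> carrier_mat (2 ^ n) n" and S: "S \<subseteq> questions n" "S \<noteq> {}"
  shows "separable n P S \<longleftrightarrow> uniform (2 ^ n) (entry P) S (questions n - S)"
proof (cases "S = questions n")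
  case True
  then show ?thesis
    by (auto simp: separable_def uniform_def slice_def)
next
  case False
  then show ?thesis
    using S restricted_matrix_eq_iff[OF P S(1)] by (auto simp: separable_def uniform_iff_outcomes)
qed

section \<open>Rows of a preference matrix\<close>

lemma preference_matrix_row_exists:
  assumes "preference_matrix n P" "x \<in> questions n \<rightarrow> {0, 1}"
  shows "\<exists>i<2 ^ n. \<forall>q\<in>questions n. entry P i q = x q"
proof -
  have "restrict x (questions n) \<in> outcome_at P (questions n) ` {..<2 ^ n}"
    using assms unfolding preference_matrix_def bij_betw_def outcomes_def by auto
  then show ?thesis
    by (auto simp: outcome_at_entry restrict_eq_iff)
qed

lemma preference_matrix_row_unique:
  assumes "preference_matrix n P" "i < 2 ^ n" "j < 2 ^ n"
    "\<And>q. q \<in> questions n \<Longrightarrow> entry P i q = entry P j q"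
  shows "i = j"
proof -
  have "inj_on (outcome_at P (questions n)) {..<2 ^ n}"
    using assms(1) by (simp add: preference_matrix_def bij_betw_def)
  moreover have "outcome_at P (questions n) i = outcome_at P (questions n) j"
    using assms(4) by (auto simp: outcome_at_entry restrict_eq_iff)
  ultimately show ?thesis
    using assms(2,3) by (auto dest: inj_onD)
qed

lemma preference_matrix_entry:
  assumes "preference_matrix n P" "i < 2 ^ n"
  shows "entry P i \<in> questions n \<rightarrow> {0, 1}"
proof -
  have "outcome_at P (questions n) i \<in> outcomes (questions n)"
    using assms by (auto simp: preference_matrix_def bij_betw_def)
  then show ?thesis
    by (auto simp: outcome_at_entry outcomes_def)
qed

text \<open>Each outcome is exactly one row, so every list has a single entry, the function that is
  \<open>undefined\<close> everywhere. This reconciles the convention that the empty set is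
  separable with \<open>uniform\<close>, as the case \<open>T = {}\<close> of the theorem
  requires.\<close>

lemma uniform_empty:
  assumes "preference_matrix n P"
  shows "uniform (2 ^ n) (entry P) {} (questions n)"
proof -
  have "slice (2 ^ n) (entry P) {} (questions n) x = [\<lambda>_. undefined]"
    if x: "x \<in> questions n \<rightarrow> {0, 1}" for x
  proof -
    obtain i where i: "i < 2 ^ n" "\<forall>q\<in>questions n. entry P i q = x q"
      using preference_matrix_row_exists[OF assms x] by blast
    have "j = i" if "j < 2 ^ n" "\<forall>q\<in>questions n. entry P j q = x q" for j
      by (rule preference_matrix_row_unique[OF assms that(1) i(1)]) (simp add: that(2) i(2))
    then have "{j. j < 2 ^ n \<and> (\<forall>q\<in>questions n. entry P j q = x q)} = {i}"
      using i by blast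
    then have "length (filter (\<lambda>i. \<forall>q\<in>questions n. entry P i q = x q) [0..<2 ^ n]) = 1"
      by (simp add: length_filter_conv_card cong: conj_cong)
    then show ?thesis
      unfolding slice_def by (auto simp: length_Suc_conv restrict_def)
  qed
  then show ?thesis
    by (simp add: uniform_def)
qed

lemma separable_iff_uniform_pref:
  assumes "preference_matrix n P" "S \<subseteq> questions n"
  shows "separable n P S \<longleftrightarrow> uniform (2 ^ n) (entry P) S (questions n - S)"
proof (cases "S = {}")
  case True
  then show ?thesis
    using uniform_empty[OF assms(1)] by (simp add: separable_def)
next
  case False
  then show ?thesis
    using assms by (simp add: separable_iff_uniform preference_matrix_def)
qed

text \<open>Rows in one list agree off \<open>S\<close>; if they also agree on \<open>S\<close>,
  they are the same row.\<close>

lemma distinct_slice: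
  assumes "preference_matrix n P" "S \<subseteq> questions n"
  shows "distinct (slice (2 ^ n) (entry P) S (questions n - S) x)"
proof -
  have "i = j" if "i < 2 ^ n" "j < 2 ^ n" "\<forall>q\<in>questions n - S. entry P i q = x q"
    "\<forall>q\<in>questions n - S. entry P j q = x q" "restrict (entry P i) S = restrict (entry P j) S" for i j
  proof (rule preference_matrix_row_unique[OF assms(1) that(1,2)])
    fix q assume "q \<in> questions n"
    then show "entry P i q = entry P j q"
      using that(3-5) by (cases "q \<in> S") (simp_all add: restrict_eq_iff)
  qed
  then show ?thesis
    by (auto simp: slice_def distinct_map intro!: inj_onI)
qed

section \<open>Renumbering the questions around the new one\<close>

definition up :: "nat \<Rightarrow> nat \<Rightarrow> nat"
  where "up k q = (if q < k then q else q + 1)"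

text \<open>The inverse of \<open>up k\<close> away from \<open>k\<close>. Its value at
  \<open>k\<close> carries no meaning; question \<open>k\<close> is always handled separately or
  lies outside the set considered.\<close>

definition down :: "nat \<Rightarrow> nat \<Rightarrow> nat"
  where "down k q = (if q < k then q else q - 1)"

lemma down_up [simp]: "down k (up k q) = q"
  by (simp add: up_def down_def)

lemma up_neq [simp]: "up k q \<noteq> k"
  by (simp add: up_def)

lemma notin_up_image [simp]: "k \<notin> up k ` D"
  by (metis imageE up_neq)

lemma inj_up: "inj (up k)"
  by (metis down_up injI)

lemma up_down: "q \<noteq> k \<Longrightarrow> up k (down k q) = q"
  by (auto simp: up_def down_def)

lemma shift_set_eq_image: "shift_set k T = up k ` T"
  by (auto simp: shift_set_def up_def image_iff)

lemma up_image_questions: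
  assumes "1 \<le> k" "k \<le> n + 1"
  shows "up k ` questions n = questions (n + 1) - {k}"
proof
  show "up k ` questions n \<subseteq> questions (n + 1) - {k}"
    by (auto simp: questions_def up_def)
  show "questions (n + 1) - {k} \<subseteq> up k ` questions n"
  proof
    fix q assume q: "q \<in> questions (n + 1) - {k}"
    then have "down k q \<in> questions n"
      using assms by (auto simp: questions_def down_def)
    moreover have "q = up k (down k q)"
      using q by (simp add: up_down)
    ultimately show "q \<in> up k ` questions n"
      by blast
  qed
qed

lemma slice_add:
  "slice (N + M) F S C x = slice N F S C x @ slice M (\<lambda>i. F (i + N)) S C x"
proof -
  have "[0..<N + M] = [0..<N] @ map (\<lambda>i. i + N) [0..<M]"
    using upt_add_eq_append[of 0 N M] by (simp add: map_add_upt add.commute[of M N])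
  then show ?thesis
    by (simp add: slice_def filter_map o_def)
qed

text \<open>Turns a restricted row of a block into the corresponding restricted row of the stack.
  The constant \<open>c\<close> is the entry of the block in the new column; it is visible only if
  \<open>k \<in> S\<close>.\<close>

definition relabel :: "nat \<Rightarrow> nat \<Rightarrow> nat set \<Rightarrow> (nat \<Rightarrow> nat) \<Rightarrow> nat \<Rightarrow> nat"
  where "relabel k c S g = (\<lambda>q\<in>S. if q = k then c else g (down k q))"

text \<open>Within one block column \<open>k\<close> is constant, so a condition on question
  \<open>k\<close> keeps all rows or none; the other conditions carry over along
  \<open>up k\<close>.\<close>

lemma slice_relabel:
  assumes "\<And>i. i < N \<Longrightarrow> F' i k = c"
    and "\<And>i q. i < N \<Longrightarrow> q \<in> T \<union> D \<Longrightarrow> F' i (up k q) = F i q"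
    and "S = up k ` T \<or> S = insert k (up k ` T)"
    and "C = up k ` D \<or> C = insert k (up k ` D)"
  shows "slice N F' S C x =
    (if k \<in> C \<and> x k \<noteq> c then [] else map (relabel k c S) (slice N F T D (x \<circ> up k)))"
proof -
  have "restrict (F' i) S = relabel k c S (restrict (F i) T)" if "i < N" for i
    using assms(1,2)[OF that] assms(3) by (auto simp: relabel_def restrict_def fun_eq_iff)
  moreover have "(\<forall>q\<in>C. F' i q = x q) \<longleftrightarrow>
      (k \<in> C \<longrightarrow> x k = c) \<and> (\<forall>q\<in>D. F i q = (x \<circ> up k) q)" if "i < N" for i
    using assms(1,2)[OF that] assms(4) notin_up_image[of k D] by fastforce
  then have "filter (\<lambda>i. \<forall>q\<in>C. F' i q = x q) [0..<N] =
      filter (\<lambda>i. (k \<in> C \<longrightarrow> x k = c) \<and> (\<forall>q\<in>D. F i q = (x \<circ> up k) q)) [0..<N]"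
    by (intro filter_cong) auto
  ultimately show ?thesis
    by (auto simp: slice_def)
qed

lemma map_relabel_slice:
  assumes "up k ` T \<subseteq> S"
  shows "map (\<lambda>h. \<lambda>q\<in>T. h (up k q)) (map (relabel k c S) (slice N F T D x)) = slice N F T D x"
  unfolding slice_def map_map
  using assms by (auto simp: relabel_def restrict_def fun_eq_iff)

text \<open>Reading a relabelled row back along \<open>up k\<close> undoes \<open>relabel\<close>
  whatever the constant is. Allowing \<open>c\<close> and \<open>c'\<close> to differ makes it
  possible to compare an upper list with a lower one.\<close>

lemma inj_map_relabel_slice:
  assumes "up k ` T \<subseteq> S"
    "map (relabel k c S) (slice N F T D x) = map (relabel k c' S) (slice M G T D' y)"
  shows "slice N F T D x = slice M G T D' y"
  using map_relabel_slice[OF assms(1)] assms(2) by metis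

section \<open>Stacking two blocks of rows\<close>

locale stacking =
  fixes N :: nat and F G H :: "nat \<Rightarrow> nat \<Rightarrow> nat" and k :: nat and Q :: "nat set"
  assumes upper_k: "i < N \<Longrightarrow> H i k = 1"
    and lower_k: "i < N \<Longrightarrow> H (i + N) k = 0"
    and upper: "i < N \<Longrightarrow> q \<in> Q \<Longrightarrow> H i (up k q) = F i q"
    and lower: "i < N \<Longrightarrow> q \<in> Q \<Longrightarrow> H (i + N) (up k q) = G i q"
begin

lemma slice_stacked:
  assumes "T \<subseteq> Q" "D \<subseteq> Q" "S = up k ` T \<or> S = insert k (up k ` T)"
    "C = up k ` D \<or> C = insert k (up k ` D)"
  shows "slice (N + N) H S C x =
    (if k \<in> C \<and> x k \<noteq> 1 then [] else map (relabel k 1 S) (slice N F T D (x \<circ> up k))) @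
    (if k \<in> C \<and> x k \<noteq> 0 then [] else map (relabel k 0 S) (slice N G T D (x \<circ> up k)))"
proof -
  have "slice N H S C x =
    (if k \<in> C \<and> x k \<noteq> 1 then [] else map (relabel k 1 S) (slice N F T D (x \<circ> up k)))"
    by (rule slice_relabel) (use assms upper_k upper in auto)
  moreover have "slice N (\<lambda>i. H (i + N)) S C x =
    (if k \<in> C \<and> x k \<noteq> 0 then [] else map (relabel k 0 S) (slice N G T D (x \<circ> up k)))"
    by (rule slice_relabel) (use assms lower_k lower in auto)
  ultimately show ?thesis
    by (simp add: slice_add)
qed

lemma uniform_stacked_iff:
  assumes "T \<subseteq> Q" "D \<subseteq> Q"
  shows "uniform (N + N) H (insert k (up k ` T)) (up k ` D) \<longleftrightarrow> uniform N F T D \<and> uniform N G T D"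
proof -
  let ?S = "insert k (up k ` T)" and ?C = "up k ` D"
  have sl: "slice (N + N) H ?S ?C x = map (relabel k 1 ?S) (slice N F T D (x \<circ> up k)) @
      map (relabel k 0 ?S) (slice N G T D (x \<circ> up k))" for x
    using slice_stacked[OF assms, of ?S ?C x] by simp
  have eq_iff: "slice (N + N) H ?S ?C x = slice (N + N) H ?S ?C y \<longleftrightarrow>
      slice N F T D (x \<circ> up k) = slice N F T D (y \<circ> up k) \<and>
      slice N G T D (x \<circ> up k) = slice N G T D (y \<circ> up k)" for x y
  proof
    assume eq: "slice (N + N) H ?S ?C x = slice (N + N) H ?S ?C y"
    \<comment> \<open>Since \<open>k\<close> belongs to \<open>?S\<close>, the entry at
      \<open>k\<close> survives the restriction and tells which block a list entry comes
      from.\<close>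
    have 1: "filter (\<lambda>h. h k = 1) (slice (N + N) H ?S ?C x) =
        map (relabel k 1 ?S) (slice N F T D (x \<circ> up k))" for x
      unfolding sl by (simp add: filter_map o_def relabel_def)
    have 0: "filter (\<lambda>h. h k = 0) (slice (N + N) H ?S ?C x) =
        map (relabel k 0 ?S) (slice N G T D (x \<circ> up k))" for x
      unfolding sl by (simp add: filter_map o_def relabel_def)
    have "map (relabel k 1 ?S) (slice N F T D (x \<circ> up k)) =
        map (relabel k 1 ?S) (slice N F T D (y \<circ> up k))"
      "map (relabel k 0 ?S) (slice N G T D (x \<circ> up k)) =
        map (relabel k 0 ?S) (slice N G T D (y \<circ> up k))"
      using eq by (simp_all only: 0[symmetric] 1[symmetric])
    then show "slice N F T D (x \<circ> up k) = slice N F T D (y \<circ> up k) \<and>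
        slice N G T D (x \<circ> up k) = slice N G T D (y \<circ> up k)"
      using inj_map_relabel_slice[of k T ?S] by (meson subset_insertI)
  qed (simp add: sl)
  show ?thesis
  proof (intro iffI conjI)
    assume u: "uniform (N + N) H ?S ?C"
    have *: "slice N F T D x = slice N F T D y \<and> slice N G T D x = slice N G T D y"
      if "x \<in> D \<rightarrow> {0, 1}" "y \<in> D \<rightarrow> {0, 1}" for x y
    proof -
      \<comment> \<open>Outcomes on \<open>D\<close> become outcomes on \<open>?C\<close> by
        \<open>down k\<close>; composing with \<open>up k\<close> afterwards gives them
        back.\<close>
      have "x \<circ> down k \<in> ?C \<rightarrow> {0, 1}" "y \<circ> down k \<in> ?C \<rightarrow> {0, 1}"
        using that by (simp_all add: Pi_iff)
      then have "slice (N + N) H ?S ?C (x \<circ> down k) = slice (N + N) H ?S ?C (y \<circ> down k)"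
        using u unfolding uniform_def by blast
      then show ?thesis
        unfolding eq_iff by (simp add: o_def)
    qed
    show "uniform N F T D" "uniform N G T D"
      using * unfolding uniform_def by blast+
  next
    assume u: "uniform N F T D \<and> uniform N G T D"
    have "x \<circ> up k \<in> D \<rightarrow> {0, 1}" if "x \<in> ?C \<rightarrow> {0, 1}" for x :: "nat \<Rightarrow> nat"
      using that by (simp add: Pi_iff)
    then show "uniform (N + N) H ?S ?C"
      using u unfolding uniform_def eq_iff by blast
  qed
qed

text \<open>Two outcomes that extend \<open>r\<close> and differ only at \<open>k\<close> select the
  rows of different blocks. As \<open>k\<close> is not among the questions kept, uniformity equates
  the list of one block with that of the other.\<close>

lemma uniform_stacked_imp_slices_eq:
  assumes "T \<subseteq> Q" "D \<subseteq> Q" "uniform (N + N) H (up k ` T) (insert k (up k ` D))"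
    and r: "r \<in> D \<rightarrow> {0, 1}"
  shows "slice N F T D r = slice N G T D r"
proof -
  let ?S = "up k ` T" and ?C = "insert k (up k ` D)"
  define x where "x c q = (if q = k then c else r (down k q))" for c q
  have "x c \<in> ?C \<rightarrow> {0, 1}" if "c \<in> {0, 1}" for c
    using r that by (simp add: x_def Pi_iff)
  then have "slice (N + N) H ?S ?C (x 1) = slice (N + N) H ?S ?C (x 0)"
    using assms(3) unfolding uniform_def by (meson insertCI)
  moreover have "x c \<circ> up k = r" for c
    by (auto simp: x_def)
  then have "slice (N + N) H ?S ?C (x 1) = map (relabel k 1 ?S) (slice N F T D r)"
    "slice (N + N) H ?S ?C (x 0) = map (relabel k 0 ?S) (slice N G T D r)"
    using slice_stacked[OF assms(1,2), of ?S ?C] by (simp_all add: x_def)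
  ultimately show ?thesis
    using inj_map_relabel_slice[of k T ?S] by (metis order_refl)
qed

end

section \<open>The stacked matrix and the row common to its blocks\<close>

lemma stacking_stack1:
  assumes "P1 \<in> carrier_mat (2 ^ n) n" "P2 \<in> carrier_mat (2 ^ n) n" "1 \<le> k" "k \<le> n + 1"
  shows "stacking (2 ^ n) (entry P1) (entry P2) (entry (stack1 k P1 P2)) k (questions n)"
proof -
  have dims: "dim_row P1 = 2 ^ n" "dim_row P2 = 2 ^ n" "dim_col P1 = n" "dim_col P2 = n"
    using assms(1,2) by auto
  \<comment> \<open>Columns count from 0 and questions from 1. As \<open>k\<close> and
    \<open>q\<close> are at least 1, \<open>q - 1 = k - 1\<close> means \<open>q = k\<close>, and a
    later question is found in its block one column to the left.\<close>
  have index: "entry (stack1 k P1 P2) i q =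
      (if q = k then (if i < 2 ^ n then 1 else 0)
       else if i < 2 ^ n then entry P1 i (down k q) else entry P2 (i - 2 ^ n) (down k q))"
    if "i < 2 ^ n + 2 ^ n" "1 \<le> q" "q \<le> n + 1" for i q
    using that assms(3,4)
    by (auto simp: entry_def stack1_def down_def append_rows_def dims)
  show ?thesis
    using assms(3,4)
    by unfold_locales (auto simp: index questions_def up_def down_def)
qed

lemma slices_differ_at_common_row:
  assumes A: "preference_matrix n A" and B: "preference_matrix n B"
    and r: "\<And>q. q \<in> questions n \<Longrightarrow> entry B 0 q = entry A (2 ^ n - 1) q"
    and T: "T \<subseteq> questions n" "T \<noteq> {}"
  defines "D \<equiv> questions n - T" and "x \<equiv> entry B 0"
  shows "slice (2 ^ n) (entry A) T D x \<noteq> slice (2 ^ n) (entry B) T D x"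
proof
  let ?a = "slice (2 ^ n) (entry A) T D x" and ?b = "slice (2 ^ n) (entry B) T D x"
  assume eq: "?a = ?b"
  \<comment> \<open>The last row of \<open>A\<close> agrees with \<open>x\<close> on all questions,
    so it passes the filter and its restriction ends \<open>?a\<close>. Likewise row 0 of
    \<open>B\<close> begins \<open>?b\<close>.\<close>
  have "[0..<2 ^ n] = [0..<2 ^ n - 1] @ [2 ^ n - 1 :: nat]"
    using upt_Suc_append[of 0 "2 ^ n - 1"] by simp
  moreover have "restrict (entry A (2 ^ n - 1)) T = restrict x T"
    "\<forall>q\<in>D. entry A (2 ^ n - 1) q = x q"
    using r T(1) unfolding x_def D_def by (auto simp: restrict_eq_iff)
  ultimately obtain as where a: "?a = as @ [restrict x T]"
    unfolding slice_def by simp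
  have "[0..<2 ^ n] = (0 :: nat) # [1..<2 ^ n]"
    by (simp add: upt_conv_Cons)
  then obtain bs where b: "?b = restrict x T # bs"
    unfolding slice_def x_def by simp
  \<comment> \<open>If the lists are equal, \<open>?a\<close> begins and ends with the same entry,
    so absence of repetitions leaves only one.\<close>
  have "distinct ?a"
    unfolding D_def by (rule distinct_slice[OF A T(1)])
  then have a1: "?a = [restrict x T]"
    using a b eq by (cases as) auto
  obtain t where t: "t \<in> T"
    using T(2) by blast
  \<comment> \<open>Flipping the answer to a question in \<open>T\<close> leaves the outcome on
    \<open>D\<close> unchanged, so the row of \<open>A\<close> with outcome \<open>y\<close>
    contributes an entry to \<open>?a\<close> different from the one already there.\<close>
  define y where "y = x(t := 1 - x t)"
  have "x \<in> questions n \<rightarrow> {0, 1}"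
    unfolding x_def using preference_matrix_entry[OF B] by simp
  moreover from this have "x t \<in> {0, 1}"
    using t T(1) by blast
  ultimately have "y \<in> questions n \<rightarrow> {0, 1}" and yt: "y t \<noteq> x t"
    by (auto simp: y_def Pi_iff)
  then obtain i where i: "i < 2 ^ n" "\<forall>q\<in>questions n. entry A i q = y q"
    using preference_matrix_row_exists[OF A] by blast
  have "\<forall>q\<in>D. entry A i q = x q"
    using i t unfolding D_def y_def by auto
  then have "restrict (entry A i) T \<in> set ?a"
    using i(1) by (auto simp: slice_def)
  then have "entry A i t = x t"
    using t by (simp add: a1 restrict_eq_iff)
  then show False
    using i(2) t T(1) yt by auto
qed

theorem theorem4:
  fixes n k :: nat and P1 P2 :: "nat mat" and C1 C2 :: "nat set set"
  assumes "P1 \<in> hamiltonian_matrices n"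
    and "P2 \<in> stackable n P1"
    and "character n P1 = C1"
    and "character n P2 = C2"
    and "1 \<le> k" and "k \<le> n + 1"
  shows "character (n + 1) (stack1 k P1 P2) =
           {shift_set k T \<union> {k} | T. T \<in> C1 \<inter> C2} \<union> {{}}"
proof -
  let ?P = "stack1 k P1 P2" and ?Q = "questions n" and ?Q' = "questions (n + 1)"
  have P1: "preference_matrix n P1" and P2: "preference_matrix n P2"
    and row: "row P2 0 = row P1 (2 ^ n - 1)"
    using assms(1,2) by (auto simp: hamiltonian_matrices_def stackable_def)
  have P1c: "P1 \<in> carrier_mat (2 ^ n) n" and P2c: "P2 \<in> carrier_mat (2 ^ n) n"
    using P1 P2 by (auto simp: preference_matrix_def)
  have common: "entry P2 0 q = entry P1 (2 ^ n - 1) q" if "q \<in> ?Q" for q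
  proof -
    have "q - 1 < n"
      using that by (auto simp: questions_def)
    then show ?thesis
      using arg_cong[OF row, of "\<lambda>v. v $ (q - 1)"] P1c P2c by (simp add: entry_def)
  qed
  have Pc: "?P \<in> carrier_mat (2 ^ (n + 1)) (n + 1)"
    using P1c P2c by (auto simp: stack1_def)
  interpret stacking "2 ^ n" "entry P1" "entry P2" "entry ?P" k ?Q
    by (rule stacking_stack1[OF P1c P2c assms(5,6)])
  have img: "up k ` ?Q = ?Q' - {k}"
    by (rule up_image_questions[OF assms(5,6)])
  have kQ: "k \<in> ?Q'"
    using assms(5,6) by (simp add: questions_def)
  have insert_k: "?Q' = insert k (up k ` ?Q)"
    using img kQ by blast
  \<comment> \<open>Here \<open>T\<close> may be empty: the set considered in the stack still
    contains \<open>k\<close>, and for the blocks \<open>uniform_empty\<close> covers this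
    case.\<close>
  have with_k: "separable (n + 1) ?P (insert k (up k ` T)) \<longleftrightarrow> T \<in> C1 \<inter> C2" if T: "T \<subseteq> ?Q" for T
  proof -
    have sub: "insert k (up k ` T) \<subseteq> ?Q'"
      using T img kQ by auto
    have "?Q' - insert k (up k ` T) = up k ` (?Q - T)"
      using img by (simp add: image_set_diff[OF inj_up]) blast
    then have "separable (n + 1) ?P (insert k (up k ` T)) \<longleftrightarrow>
        uniform (2 ^ n + 2 ^ n) (entry ?P) (insert k (up k ` T)) (up k ` (?Q - T))"
      using separable_iff_uniform[OF Pc sub] by (simp add: mult_2)
    also have "\<dots> \<longleftrightarrow> T \<in> C1 \<inter> C2"
      using uniform_stacked_iff[of T "?Q - T"] T assms(3,4)
        separable_iff_uniform_pref[OF P1 T] separable_iff_uniform_pref[OF P2 T]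
      by (auto simp: character_def)
    finally show ?thesis .
  qed
  have without_k: "\<not> separable (n + 1) ?P (up k ` T)" if T: "T \<subseteq> ?Q" "T \<noteq> {}" for T
  proof
    assume sep: "separable (n + 1) ?P (up k ` T)"
    have sub: "up k ` T \<subseteq> ?Q'" "up k ` T \<noteq> {}"
      using T img by auto
    have "?Q' - up k ` T = insert k (up k ` (?Q - T))"
      unfolding insert_k by (simp add: insert_Diff_if image_set_diff[OF inj_up])
    then have "uniform (2 ^ n + 2 ^ n) (entry ?P) (up k ` T) (insert k (up k ` (?Q - T)))"
      using sep separable_iff_uniform[OF Pc sub] by (simp add: mult_2)
    \<comment> \<open>The common row supplies the outcome off \<open>T\<close> at which the two
      block lists are compared.\<close>
    moreover have "entry P2 0 \<in> ?Q - T \<rightarrow> {0, 1}"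
      using preference_matrix_entry[OF P2, of 0] by (simp add: Pi_iff)
    ultimately show False
      using uniform_stacked_imp_slices_eq[of T "?Q - T" "entry P2 0"] T(1)
        slices_differ_at_common_row[OF P1 P2 common T] by blast
  qed
  show ?thesis
  proof (intro equalityI subsetI)
    fix S assume "S \<in> character (n + 1) ?P"
    then have S: "S \<subseteq> ?Q'" and sep: "separable (n + 1) ?P S"
      by (auto simp: character_def)
    \<comment> \<open>Apart from \<open>k\<close>, every question of the stack is a renumbered old
      one, so \<open>S\<close> comes from some \<open>T\<close>. If \<open>k\<close> is not in
      \<open>S\<close>, then \<open>without_k\<close> forces \<open>T\<close>, and with it
      \<open>S\<close>, to be empty.\<close>
    have "S - {k} \<subseteq> up k ` ?Q"
      using S img by auto
    then obtain T where T: "T \<subseteq> ?Q" "S - {k} = up k ` T"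
      by (meson subset_imageE)
    show "S \<in> {shift_set k T \<union> {k} | T. T \<in> C1 \<inter> C2} \<union> {{}}"
    proof (cases "k \<in> S")
      case True
      then have "S = insert k (up k ` T)"
        using T(2) by auto
      then show ?thesis
        using with_k[OF T(1)] sep by (auto simp: shift_set_eq_image)
    next
      case False
      then show ?thesis
        using T without_k[OF T(1)] sep by auto
    qed
  next
    fix S assume "S \<in> {shift_set k T \<union> {k} | T. T \<in> C1 \<inter> C2} \<union> {{}}"
    then consider "S = {}" | T where "S = insert k (up k ` T)" "T \<in> C1 \<inter> C2"
      by (auto simp: shift_set_eq_image)
    then show "S \<in> character (n + 1) ?P"
    proof cases
      case 1
      then show ?thesis
        by (simp add: character_def separable_def)
    next
      case 2
      then have "T \<subseteq> ?Q"
        using assms(3) by (auto simp: character_def)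
      then show ?thesis
        using 2 with_k img kQ by (auto simp: character_def)
    qed
  qed
qed

end
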